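(* Let $N\ge 3$, let $a,b>0$, and let $E=\{(x,y)\in\mathbb{R}^2:\ x^2/a^2+y^2/b^2=1\}$, with center the origin $O$. Consider a family of $N$-periodic billiard trajectories in $E$, with consecutive vertices $P_1,\dots,P_N$ (indices modulo $N$), and let $\gamma>0$ be its Joachimsthal constant. Fix $i$, and for each trajectory of the family let $z$ be the intersection of the tangent line to $E$ at $P_i$ (an edge line of the tangential polygon) with the reflection about $O$ of the tangent line to $E$ at $P_{i+1}$ (the reflection of the next edge line of the tangential polygon). Then, as the trajectory ranges over the family, the locus of $z$ is a circle centered at $O$, and its radius is $r^*=1/\gamma$.
   Context: Elliptic billiard: a particle moves in straight lines at constant speed inside $E$ and bounces elastically on $E$, i.e. at each bounce point the incoming and outgoing segments make equal angles with the normal to $E$. An $N$-periodic trajectory (orbit) is a billiard trajectory that closes after $N$ bounces, i.e. a closed polygon with $N$ vertices on $E$ satisfying this reflection law at each vertex. A family of $N$-periodic trajectories is the one-parameter family of $N$-periodic trajectories in $E$ given by Poncelet's porism: all of them have their sides tangent to one and the same ellipse (the caustic), nested in $E$ and confocal with $E$; every point of $E$ can be taken as the starting vertex $P_1$ of a member of the family, and the vertices are labeled in the order of the bounces, with the same orientation throughout the family. The tangential polygon of a trajectory is the polygon whose edges lie on the tangent lines to $E$ at $P_1,\dots,P_N$ (consecutive tangent lines meeting at its vertices); for $N=3$ it is the excentral triangle. Joachimsthal constant: with $f(x,y)=(x/a)^2+(y/b)^2$ and $\nabla f_i=2\left(\frac{x_i}{a^2},\frac{y_i}{b^2}\right)$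 its gradient at $P_i=(x_i,y_i)$, set $\gamma=\frac12\,\hat v\cdot\nabla f_i>0$, where $\hat v=(P_i-P_{i-1})/\|P_i-P_{i-1}\|$ is the incoming unit velocity at $P_i$. The value of $\gamma$ is the same for all bounces of a trajectory and for all trajectories of the family. *)

theory Defs
  imports "HOL-Analysis.Analysis"
begin

definition ellipse_form :: "real \<Rightarrow> real \<Rightarrow> real \<times> real \<Rightarrow> real" where
  "ellipse_form a b p = (fst p / a)\<^sup>2 + (snd p / b)\<^sup>2"

definition ellipse_grad :: "real \<Rightarrow> real \<Rightarrow> real \<times> real \<Rightarrow> real \<times> real" where
  "ellipse_grad a b p = (2 * fst p / a\<^sup>2, 2 * snd p / b\<^sup>2)"

lemma GDERIV_ellipse_form: "GDERIV (ellipse_form a b) p :> ellipse_grad a b p"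
  unfolding gderiv_def ellipse_form_def[abs_def] ellipse_grad_def
  by (rule has_derivative_eq_rhs)
    (auto intro!: derivative_eq_intros ext simp: divide_inverse power2_eq_square inner_prod_def algebra_simps)

definition ellipse :: "real \<Rightarrow> real \<Rightarrow> (real \<times> real) set" where
  "ellipse a b = {p. ellipse_form a b p = 1}"

definition tangent_line :: "real \<Rightarrow> real \<Rightarrow> real \<times> real \<Rightarrow> (real \<times> real) set" where
  "tangent_line a b p = {q. (q - p) \<bullet> ellipse_grad a b p = 0}"

definition foci :: "real \<Rightarrow> real \<Rightarrow> (real \<times> real) set" where
  "foci a b =
    (if b \<le> a then {(sqrt (a\<^sup>2 - b\<^sup>2), 0), (- sqrt (a\<^sup>2 - b\<^sup>2), 0)}
     else {(0, sqrt (b\<^sup>2 - a\<^sup>2)), (0, - sqrt (b\<^sup>2 - a\<^sup>2))})"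

definition caustic_of :: "real \<Rightarrow> real \<Rightarrow> real \<Rightarrow> real \<Rightarrow> bool" where
  "caustic_of a b a' b' \<longleftrightarrow>
    0 < a' \<and> 0 < b' \<and> foci a' b' = foci a b \<and> (\<forall>p\<in>ellipse a' b'. ellipse_form a b p < 1)"

text \<open>Elastic bounce: the velocity \<open>u\<close> is reversed along the normal \<open>n\<close> and kept along the tangent.\<close>

definition bounce :: "real \<times> real \<Rightarrow> real \<times> real \<Rightarrow> real \<times> real" where
  "bounce n u = u - (2 * (u \<bullet> n) / (n \<bullet> n)) *\<^sub>R n"

text \<open>
  The backward incoming direction \<open>- u\<close> and the outgoing direction \<open>bounce n u\<close>
  make equal angles with the normal.
\<close>

lemma norm_bounce: "norm (bounce n u) = norm u"
proof (cases "n = 0")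
  case False
  have "bounce n u \<bullet> bounce n u = u \<bullet> u"
    using False by (simp add: bounce_def inner_diff_left inner_diff_right inner_commute)
  then show ?thesis by (simp add: norm_eq_sqrt_inner)
qed (simp add: bounce_def)

lemma inner_bounce: "n \<noteq> 0 \<Longrightarrow> bounce n u \<bullet> n = (- u) \<bullet> n"
  by (simp add: bounce_def inner_diff_left)

text \<open>
  Vertices are indexed by the integers, periodically with period \<open>N\<close>.
  The unit vector in the direction of \<open>x\<close> is \<open>sgn x\<close>.
\<close>

definition periodic_trajectory ::
    "real \<Rightarrow> real \<Rightarrow> nat \<Rightarrow> (int \<Rightarrow> real \<times> real) \<Rightarrow> bool" where
  "periodic_trajectory a b N P \<longleftrightarrow>
    (\<forall>j. P j \<in> ellipse a b \<and> P (j + 1) \<noteq> P j \<and> P (j + int N) = P j \<and>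
      sgn (P (j + 1) - P j) = bounce (ellipse_grad a b (P j)) (sgn (P j - P (j - 1))))"

definition cross :: "real \<times> real \<Rightarrow> real \<times> real \<Rightarrow> real" where
  "cross p q = fst p * snd q - snd p * fst q"

text \<open>
  A family has a common caustic and a common sense of rotation about the origin (the centre of
  the caustic), and every point of the ellipse is the starting vertex \<open>P 1\<close> of a member.
\<close>

definition periodic_family ::
    "real \<Rightarrow> real \<Rightarrow> nat \<Rightarrow> (int \<Rightarrow> real \<times> real) set \<Rightarrow> bool" where
  "periodic_family a b N F \<longleftrightarrow>
    (\<forall>P\<in>F. periodic_trajectory a b N P) \<and>
    (\<exists>a' b'. caustic_of a b a' b' \<and>
      (\<forall>P\<in>F. \<forall>j. \<exists>q\<in>ellipse a' b'. affine hull {P j, P (j + 1)} = tangent_line a' b' q)) \<and>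
    ((\<forall>P\<in>F. \<forall>j. cross (P j) (P (j + 1)) > 0) \<or> (\<forall>P\<in>F. \<forall>j. cross (P j) (P (j + 1)) < 0)) \<and>
    (\<forall>p\<in>ellipse a b. \<exists>P\<in>F. P 1 = p)"

definition joachimsthal :: "real \<Rightarrow> real \<Rightarrow> (int \<Rightarrow> real \<times> real) \<Rightarrow> int \<Rightarrow> real" where
  "joachimsthal a b P j = 1 / 2 * (sgn (P j - P (j - 1)) \<bullet> ellipse_grad a b (P j))"

end

theory Submission
  imports Defs
begin

text \<open>
  All chords \<open>p q\<close> of \<open>E\<close> tangent to the confocal caustic with semi-axes
  \<open>sqrt (a\<^sup>2 - l)\<close>, \<open>sqrt (b\<^sup>2 - l)\<close> satisfy
  \<open>l * \<bar>p - q\<bar>\<^sup>2 = a\<^sup>2 * b\<^sup>2 * (1 - d)\<^sup>2\<close>, where \<open>d\<close> is the cosine of the difference of the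
  eccentric angles of \<open>p\<close> and \<open>q\<close>. Since \<open>\<gamma> = (1 - d) / \<bar>p - q\<bar>\<close>, this says
  \<open>\<gamma>\<^sup>2 = l / (a\<^sup>2 * b\<^sup>2)\<close>, and solving the two linear equations for \<open>z\<close> gives
  \<open>\<bar>z\<bar> = \<bar>p - q\<bar> / (1 - d)\<close>. Conversely, a point \<open>z\<close> with \<open>\<bar>z\<bar> = 1/\<gamma>\<close> lies outside \<open>E\<close>; the
  contact point of one tangent from \<open>z\<close> and the antipode of the other contact point form a
  chord satisfying the same equation. From a given point and in a given sense of rotation there
  is only one such chord, so it is a side of a member of the family.
\<close>

section \<open>Chords and tangent lines in normalised coordinates\<close>

text \<open>Squaring keeps the condition polynomial and symmetric in \<open>p\<close> and
  \<open>q\<close>. For \<open>p = q\<close> on \<open>E\<close> it holds trivially, both sides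
  being 0.\<close>

definition confocal_chord :: "real \<Rightarrow> real \<Rightarrow> real \<Rightarrow> real \<times> real \<Rightarrow> real \<times> real \<Rightarrow> bool" where
  "confocal_chord a b l p q \<longleftrightarrow>
    l * (norm (p - q))\<^sup>2 = (a * b * (1 - fst p * fst q / a\<^sup>2 - snd p * snd q / b\<^sup>2))\<^sup>2"

lemma confocal_chord_commute: "confocal_chord a b l p q \<longleftrightarrow> confocal_chord a b l q p"
  by (simp add: confocal_chord_def norm_minus_commute mult.commute)

lemma cross_commute: "cross q p = - cross p q"
  by (simp add: cross_def)

lemma cross_scaled: "cross (a * x, b * y) (a * x', b * y') = a * b * (x * y' - y * x')"
  by (simp add: cross_def algebra_simps)

lemma norm_sq_pair: "(norm (x, y))\<^sup>2 = x\<^sup>2 + y\<^sup>2" for x y :: real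
  by (simp add: norm_Pair)

lemma ellipse_scaled_iff:
  assumes "a > 0" "b > 0"
  shows "(a * x, b * y) \<in> ellipse a b \<longleftrightarrow> x\<^sup>2 + y\<^sup>2 = 1"
  using assms by (simp add: ellipse_def ellipse_form_def)

lemma ellipse_scaledE:
  assumes "a > 0" "b > 0" "p \<in> ellipse a b"
  obtains x y where "p = (a * x, b * y)" "x\<^sup>2 + y\<^sup>2 = 1"
proof
  show "p = (a * (fst p / a), b * (snd p / b))" using assms by simp
  show "(fst p / a)\<^sup>2 + (snd p / b)\<^sup>2 = 1" using assms by (simp add: ellipse_def ellipse_form_def)
qed

lemma confocal_chord_scaled:
  assumes "a > 0" "b > 0"
  shows "confocal_chord a b l (a * x, b * y) (a * x', b * y') \<longleftrightarrow>
    l * (a\<^sup>2 * (x - x')\<^sup>2 + b\<^sup>2 * (y - y')\<^sup>2) = (a * b * (1 - x * x' - y * y'))\<^sup>2"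
proof -
  have "a * x * (a * x') / a\<^sup>2 = x * x'" "b * y * (b * y') / b\<^sup>2 = y * y'"
    using assms by (simp_all add: power2_eq_square)
  moreover have "(norm ((a * x, b * y) - (a * x', b * y')))\<^sup>2 = a\<^sup>2 * (x - x')\<^sup>2 + b\<^sup>2 * (y - y')\<^sup>2"
    by (simp add: norm_sq_pair) (simp add: power2_eq_square algebra_simps)
  ultimately show ?thesis by (simp add: confocal_chord_def)
qed

lemma tangent_line_iff:
  assumes "a > 0" "b > 0" "p \<in> ellipse a b"
  shows "q \<in> tangent_line a b p \<longleftrightarrow> fst q * fst p / a\<^sup>2 + snd q * snd p / b\<^sup>2 = 1"
proof -
  define S where "S = fst q * fst p / a\<^sup>2 + snd q * snd p / b\<^sup>2"
  have "fst p * fst p / a\<^sup>2 + snd p * snd p / b\<^sup>2 = 1"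
    using assms by (simp add: ellipse_def ellipse_form_def power2_eq_square)
  moreover have "(q - p) \<bullet> ellipse_grad a b p = 2 * S - 2 * (fst p * fst p / a\<^sup>2 + snd p * snd p / b\<^sup>2)"
    using assms by (simp add: S_def ellipse_grad_def inner_prod_def field_simps)
  ultimately show ?thesis by (simp add: tangent_line_def flip: S_def)
qed

lemma tangent_line_scaled_iff:
  assumes "a > 0" "b > 0" "x\<^sup>2 + y\<^sup>2 = 1"
  shows "q \<in> tangent_line a b (a * x, b * y) \<longleftrightarrow> fst q / a * x + snd q / b * y = 1"
  using assms by (simp add: tangent_line_iff ellipse_scaled_iff power2_eq_square)

lemma uminus_image_tangent_line_scaled_iff:
  assumes "a > 0" "b > 0" "x\<^sup>2 + y\<^sup>2 = 1"
  shows "q \<in> uminus ` tangent_line a b (a * x, b * y) \<longleftrightarrow> fst q / a * x + snd q / b * y = - 1"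
proof -
  have "q \<in> uminus ` tangent_line a b (a * x, b * y) \<longleftrightarrow> - q \<in> tangent_line a b (a * x, b * y)"
    by (metis (no_types, lifting) image_iff minus_minus)
  also have "\<dots> \<longleftrightarrow> fst q / a * x + snd q / b * y = - 1"
    using assms by (auto simp: tangent_line_scaled_iff)
  finally show ?thesis .
qed

section \<open>Chords tangent to a confocal caustic\<close>

text \<open>The foci lie on a coordinate axis, so the left side is the squared focal distance with a
  sign that tells the axis. The foci thus determine \<open>a^2 - b^2\<close> whichever semi-axis is
  larger.\<close>

lemma foci_sq_diff:
  assumes "a > 0" "b > 0" "p \<in> foci a b"
  shows "(fst p)\<^sup>2 - (snd p)\<^sup>2 = a\<^sup>2 - b\<^sup>2"
proof (cases "b \<le> a")
  case True
  then have "b\<^sup>2 \<le> a\<^sup>2" using assms by simp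
  then show ?thesis using assms True by (auto simp: foci_def)
next
  case False
  then have "a\<^sup>2 \<le> b\<^sup>2" using assms by simp
  then show ?thesis using assms False by (auto simp: foci_def)
qed

lemma caustic_of_confocal:
  assumes "a > 0" "b > 0" "caustic_of a b a' b'"
  shows "a\<^sup>2 - a'\<^sup>2 = b\<^sup>2 - b'\<^sup>2"
proof -
  obtain p where "p \<in> foci a b" by (metis foci_def insertI1)
  then have "a'\<^sup>2 - b'\<^sup>2 = a\<^sup>2 - b\<^sup>2"
    using assms foci_sq_diff[of a b p] foci_sq_diff[of a' b' p] by (simp add: caustic_of_def)
  then show ?thesis by simp
qed

text \<open>A line \<open>m X + n Y = 1\<close> touches the caustic iff
  \<open>a'^2 m^2 + b'^2 n^2 = 1\<close>. Expressing \<open>m\<close> and \<open>n\<close> through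
  the two chord ends turns this dual equation into the chord equation.\<close>

lemma confocal_chord_if_tangent:
  assumes pos: "a > 0" "b > 0" and c: "caustic_of a b a' b'"
    and pq: "p \<in> ellipse a b" "q \<in> ellipse a b"
    and t: "t \<in> ellipse a' b'" "p \<in> tangent_line a' b' t" "q \<in> tangent_line a' b' t"
  shows "confocal_chord a b (a\<^sup>2 - a'\<^sup>2) p q"
proof -
  have pos': "a' > 0" "b' > 0" using c by (auto simp: caustic_of_def)
  define l where "l = a\<^sup>2 - a'\<^sup>2"
  have a': "a'\<^sup>2 = a\<^sup>2 - l" and b': "b'\<^sup>2 = b\<^sup>2 - l"
    using caustic_of_confocal[OF pos c] by (auto simp: l_def)
  obtain x y where p: "p = (a * x, b * y)" and xy: "x\<^sup>2 + y\<^sup>2 = 1"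
    using ellipse_scaledE[OF pos pq(1)] .
  obtain u v where q: "q = (a * u, b * v)" and uv: "u\<^sup>2 + v\<^sup>2 = 1"
    using ellipse_scaledE[OF pos pq(2)] .
  \<comment> \<open>Line coordinates of the tangent at \<open>t\<close>: it is the line
    \<open>m X + n Y = 1\<close>.\<close>
  define m n where "m = fst t / a'\<^sup>2" and "n = snd t / b'\<^sup>2"
  have mn: "a * m * x + b * n * y = 1" "a * m * u + b * n * v = 1"
    using t pos' by (auto simp: tangent_line_iff p q m_def n_def mult_ac)
  have "a'\<^sup>2 * m\<^sup>2 = (fst t / a')\<^sup>2" "b'\<^sup>2 * n\<^sup>2 = (snd t / b')\<^sup>2"
    using pos' by (simp_all add: m_def n_def power2_eq_square)
  then have "(a\<^sup>2 - l) * m\<^sup>2 + (b\<^sup>2 - l) * n\<^sup>2 = 1"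
    using t(1) by (simp add: ellipse_def ellipse_form_def flip: a' b')
  then have mn1: "(a * m)\<^sup>2 + (b * n)\<^sup>2 - 1 = l * (m\<^sup>2 + n\<^sup>2)"
    by (simp add: algebra_simps)
  \<comment> \<open>\<open>C\<close> is the determinant of the system \<open>mn\<close>. Cramer's
    rule is kept in multiplied form, so \<open>C = 0\<close> needs no separate case.\<close>
  define C where "C = x * v - y * u"
  have m: "(a * m) * C = v - y" and n: "(b * n) * C = x - u"
    using mn unfolding C_def by algebra+
  have "a\<^sup>2 * b\<^sup>2 * (C\<^sup>2 * ((a * m)\<^sup>2 + (b * n)\<^sup>2 - 1)) = l * (b\<^sup>2 * ((a * m) * C)\<^sup>2 + a\<^sup>2 * ((b * n) * C)\<^sup>2)"
    unfolding mn1 by (simp add: algebra_simps power2_eq_square)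
  moreover have "C\<^sup>2 * ((a * m)\<^sup>2 + (b * n)\<^sup>2 - 1) = (1 - x * u - y * v)\<^sup>2"
  proof -
    have "C\<^sup>2 * ((a * m)\<^sup>2 + (b * n)\<^sup>2 - 1) = (v - y)\<^sup>2 + (x - u)\<^sup>2 - C\<^sup>2"
      unfolding m[symmetric] n[symmetric] by algebra
    also have "\<dots> = (1 - x * u - y * v)\<^sup>2"
      using xy uv unfolding C_def by algebra
    finally show ?thesis .
  qed
  ultimately have "l * (a\<^sup>2 * (x - u)\<^sup>2 + b\<^sup>2 * (y - v)\<^sup>2) = (a * b * (1 - x * u - y * v))\<^sup>2"
    unfolding m n by (simp add: power_mult_distrib power2_commute[of v y] add.commute)
  then show ?thesis
    unfolding p q l_def[symmetric] using confocal_chord_scaled[OF pos] by blast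
qed

section \<open>Uniqueness of the chord with a given start and sense\<close>

text \<open>
  With \<open>s\<close> the tangent of half the difference of the eccentric angles, the chord condition is a
  quadratic equation in \<open>s\<close> whose roots have opposite signs.
\<close>

lemma confocal_chord_unique:
  assumes pos: "a > 0" "b > 0" and l: "0 < l" "l < a\<^sup>2" "l < b\<^sup>2"
    and el: "p \<in> ellipse a b" "q \<in> ellipse a b" "q' \<in> ellipse a b"
    and ch: "confocal_chord a b l p q" "confocal_chord a b l p q'"
    and cr: "cross p q * cross p q' > 0"
  shows "q = q'"
proof -
  obtain x y where p: "p = (a * x, b * y)" and xy: "x\<^sup>2 + y\<^sup>2 = 1"
    using ellipse_scaledE[OF pos el(1)] .
  \<comment> \<open>Coefficients of the quadratic in \<open>s\<close>, with
    \<open>x^2 + y^2 = 1\<close> used to bring its leading coefficient into a visibly nonnegative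
    form.\<close>
  define A B G where "A = a\<^sup>2 * x\<^sup>2 * (b\<^sup>2 - l) + b\<^sup>2 * y\<^sup>2 * (a\<^sup>2 - l)"
    and "B = l * (b\<^sup>2 - a\<^sup>2) * x * y" and "G = l * (a\<^sup>2 * y\<^sup>2 + b\<^sup>2 * x\<^sup>2)"
  have ex: "\<exists>s. A * s\<^sup>2 + 2 * B * s - G = 0 \<and> s * cross p r > 0 \<and>
      r = (a * ((1 - s\<^sup>2) / (1 + s\<^sup>2) * x - 2 * s / (1 + s\<^sup>2) * y),
           b * ((1 - s\<^sup>2) / (1 + s\<^sup>2) * y + 2 * s / (1 + s\<^sup>2) * x))"
    if r: "r \<in> ellipse a b" "confocal_chord a b l p r" "cross p r \<noteq> 0" for r
  proof -
    obtain u v where ruv: "r = (a * u, b * v)" and uv: "u\<^sup>2 + v\<^sup>2 = 1"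
      using ellipse_scaledE[OF pos r(1)] .
    define C D where "C = x * v - y * u" and "D = x * u + y * v"
    have CD: "C\<^sup>2 + D\<^sup>2 = 1" using xy uv unfolding C_def D_def by algebra
    have u: "u = D * x - C * y" and v: "v = D * y + C * x"
      using xy unfolding C_def D_def by algebra+
    have crC: "cross p r = a * b * C" by (simp add: p ruv cross_scaled C_def)
    then have C: "C \<noteq> 0" using r(3) by auto
    \<comment> \<open>\<open>C\<close> and \<open>D\<close> are the sine and cosine of the angle
      from \<open>p\<close> to \<open>r\<close>, so this is the tangent of half that angle.\<close>
    define s where "s = (1 - D) / C"
    have sC: "s * C = 1 - D" using C by (simp add: s_def)
    have "l * (a\<^sup>2 * (x - u)\<^sup>2 + b\<^sup>2 * (y - v)\<^sup>2) = (a * b * (1 - D))\<^sup>2"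
      using r(2) confocal_chord_scaled[OF pos] unfolding p ruv D_def by (simp add: diff_diff_eq)
    \<comment> \<open>Both coordinates of the normalised chord contain the factor \<open>C\<close>,
      as does \<open>1 - D\<close>; hence \<open>C^2\<close> cancels from the chord
      equation.\<close>
    moreover have xu: "x - u = C * (s * x + y)" and yv: "y - v = C * (s * y - x)"
      using sC unfolding u v by algebra+
    ultimately have "C\<^sup>2 * (l * (a\<^sup>2 * (s * x + y)\<^sup>2 + b\<^sup>2 * (s * y - x)\<^sup>2)) = C\<^sup>2 * (a * b * s)\<^sup>2"
      unfolding xu yv sC[symmetric] power_mult_distrib by (simp only: distrib_left mult_ac)
    then have "l * (a\<^sup>2 * (s * x + y)\<^sup>2 + b\<^sup>2 * (s * y - x)\<^sup>2) = (a * b * s)\<^sup>2"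
      using C by simp
    then have quad: "A * s\<^sup>2 + 2 * B * s - G = 0"
      using xy unfolding A_def B_def G_def by algebra
    have "D < 1"
      using CD C by (smt (verit) one_le_power zero_less_power2)
    then have sgn: "s * cross p r > 0"
      using pos sC by (simp add: crC mult.left_commute[of s])
    have s1: "1 + s\<^sup>2 \<noteq> 0" by (smt (verit) zero_le_power2)
    have "C * (C * (1 + s\<^sup>2)) = C * (2 * s)" and "C\<^sup>2 * (D * (1 + s\<^sup>2)) = C\<^sup>2 * (1 - s\<^sup>2)"
      using sC CD by algebra+
    then have "C * (1 + s\<^sup>2) = 2 * s" "D * (1 + s\<^sup>2) = 1 - s\<^sup>2" using C by simp_all
    then have "C = 2 * s / (1 + s\<^sup>2)" "D = (1 - s\<^sup>2) / (1 + s\<^sup>2)"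
      using s1 by (simp_all add: eq_divide_eq)
    then show ?thesis using quad sgn by (auto simp: ruv u v)
  qed
  obtain s where s: "A * s\<^sup>2 + 2 * B * s - G = 0" "s * cross p q > 0" and
    q: "q = (a * ((1 - s\<^sup>2) / (1 + s\<^sup>2) * x - 2 * s / (1 + s\<^sup>2) * y),
           b * ((1 - s\<^sup>2) / (1 + s\<^sup>2) * y + 2 * s / (1 + s\<^sup>2) * x))"
    using ex[OF el(2) ch(1)] cr by force
  obtain s' where s': "A * s'\<^sup>2 + 2 * B * s' - G = 0" "s' * cross p q' > 0" and
    q': "q' = (a * ((1 - s'\<^sup>2) / (1 + s'\<^sup>2) * x - 2 * s' / (1 + s'\<^sup>2) * y),
           b * ((1 - s'\<^sup>2) / (1 + s'\<^sup>2) * y + 2 * s' / (1 + s'\<^sup>2) * x))"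
    using ex[OF el(3) ch(2)] cr by force
  have ss: "s * s' > 0"
    using s(2) s'(2) cr by (auto simp: zero_less_mult_iff)
  have "A > 0"
  proof (cases "x = 0")
    case True
    then show ?thesis using xy l pos by (simp add: A_def)
  next
    case False
    then have "a\<^sup>2 * x\<^sup>2 * (b\<^sup>2 - l) > 0" using l pos by simp
    moreover have "b\<^sup>2 * y\<^sup>2 * (a\<^sup>2 - l) \<ge> 0" using l by simp
    ultimately show ?thesis by (simp add: A_def)
  qed
  moreover have "G \<ge> 0" using l by (simp add: G_def)
  ultimately have "A * (s * s') + G > 0" using ss by (simp add: add_pos_nonneg)
  \<comment> \<open>\<open>s'\<close> times the equation for \<open>s\<close> minus \<open>s\<close>
    times the one for \<open>s'\<close>: the terms with \<open>B\<close> cancel.\<close>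
  moreover have "(s - s') * (A * (s * s') + G) = 0"
    using s(1) s'(1) by algebra
  ultimately have "s = s'" by simp
  then show ?thesis by (simp add: q q')
qed

section \<open>The Joachimsthal constant in terms of the caustic\<close>

text \<open>Half the inner product of the chord with the gradient at its end is
  \<open>1 - d\<close>. As \<open>l\<close> depends only on the caustic, the constant is the same at
  every bounce of every member.\<close>

lemma joachimsthal_confocal_chord:
  assumes pos: "a > 0" "b > 0" and el: "P (j - 1) \<in> ellipse a b" "P j \<in> ellipse a b"
    and ne: "P j \<noteq> P (j - 1)" and ch: "confocal_chord a b l (P (j - 1)) (P j)"
  shows "joachimsthal a b P j > 0" "l = (a * b * joachimsthal a b P j)\<^sup>2"
proof -
  obtain x y where p: "P (j - 1) = (a * x, b * y)" and xy: "x\<^sup>2 + y\<^sup>2 = 1"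
    using ellipse_scaledE[OF pos el(1)] .
  obtain u v where q: "P j = (a * u, b * v)" and uv: "u\<^sup>2 + v\<^sup>2 = 1"
    using ellipse_scaledE[OF pos el(2)] .
  define L where "L = norm (P (j - 1) - P j)"
  have L: "L > 0" using ne by (auto simp: L_def)
  define D where "D = 1 - x * u - y * v"
  have "ellipse_grad a b (P j) = (2 * u / a, 2 * v / b)"
    using pos by (simp add: q ellipse_grad_def power2_eq_square)
  moreover have "P j - P (j - 1) = (a * (u - x), b * (v - y))"
    by (simp add: p q right_diff_distrib)
  ultimately have "(P j - P (j - 1)) \<bullet> ellipse_grad a b (P j) = 2 * (u * (u - x) + v * (v - y))"
    using pos by simp
  also have "\<dots> = 2 * D"
    using uv unfolding D_def by algebra
  finally have inner: "(P j - P (j - 1)) \<bullet> ellipse_grad a b (P j) = 2 * D" .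
  have "norm (P j - P (j - 1)) = L"
    unfolding L_def by (rule norm_minus_commute)
  then have g: "joachimsthal a b P j = D / L"
    by (simp add: joachimsthal_def sgn_div_norm inner inverse_eq_divide)
  \<comment> \<open>Positivity: \<open>2 * D\<close> is the squared distance of two distinct points
    of the unit circle.\<close>
  have "2 * D = (x - u)\<^sup>2 + (y - v)\<^sup>2"
    using xy uv unfolding D_def by algebra
  moreover have "(x - u)\<^sup>2 + (y - v)\<^sup>2 > 0"
    using ne p q by (auto simp: sum_power2_gt_zero_iff)
  ultimately show "joachimsthal a b P j > 0" using L by (simp add: g)
  have "a * x * (a * u) / a\<^sup>2 = x * u" "b * y * (b * v) / b\<^sup>2 = y * v"
    using pos by (simp_all add: power2_eq_square)
  then have "l * L\<^sup>2 = (a * b * D)\<^sup>2"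
    using ch unfolding confocal_chord_def L_def[symmetric] by (simp add: p q D_def)
  then have "l = (a * b * D)\<^sup>2 / L\<^sup>2" using L by (simp add: eq_divide_eq)
  then show "l = (a * b * joachimsthal a b P j)\<^sup>2"
    by (simp add: g power_divide)
qed

section \<open>The intersection point \<open>z\<close> and its norm\<close>

text \<open>Reflection about the origin only changes the right side of the tangent equation from 1
  to -1. Cramer's rule applies because the two lines are not parallel.\<close>

lemma tangent_inter_reflected_tangent:
  assumes pos: "a > 0" "b > 0" and xy: "x\<^sup>2 + y\<^sup>2 = 1" and uv: "u\<^sup>2 + v\<^sup>2 = 1"
    and C: "x * v - y * u \<noteq> 0"
  shows "tangent_line a b (a * x, b * y) \<inter> uminus ` tangent_line a b (a * u, b * v) =
    {(a * ((y + v) / (x * v - y * u)), - b * ((x + u) / (x * v - y * u)))}"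
proof -
  have "fst z / a * x + snd z / b * y = 1 \<and> fst z / a * u + snd z / b * v = - 1 \<longleftrightarrow>
    z = (a * ((y + v) / (x * v - y * u)), - b * ((x + u) / (x * v - y * u)))" for z
  proof -
    define f g where "f = fst z / a" and "g = snd z / b"
    have z: "z = (a * f, b * g)" using pos by (simp add: f_def g_def)
    have "f * x + g * y = 1 \<and> f * u + g * v = - 1 \<longleftrightarrow>
      f * (x * v - y * u) = y + v \<and> g * (x * v - y * u) = - (x + u)"
    proof
      assume "f * (x * v - y * u) = y + v \<and> g * (x * v - y * u) = - (x + u)"
      then have "(x * v - y * u) * (f * x + g * y) = (x * v - y * u) * 1"
        "(x * v - y * u) * (f * u + g * v) = (x * v - y * u) * - 1"
        by algebra+
      then show "f * x + g * y = 1 \<and> f * u + g * v = - 1"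
        using C mult_left_cancel by blast
    qed algebra
    also have "\<dots> \<longleftrightarrow> f = (y + v) / (x * v - y * u) \<and> g = - (x + u) / (x * v - y * u)"
      using C by (simp only: eq_divide_eq) simp
    finally have "f * x + g * y = 1 \<and> f * u + g * v = - 1 \<longleftrightarrow>
      f = (y + v) / (x * v - y * u) \<and> g = - ((x + u) / (x * v - y * u))" by (simp only: minus_divide_left)
    also have "\<dots> \<longleftrightarrow> z = (a * ((y + v) / (x * v - y * u)), b * - ((x + u) / (x * v - y * u)))"
      using pos unfolding z prod.inject by (simp only: mult_cancel_left) simp
    finally show ?thesis
      unfolding f_def g_def by simp
  qed
  then show ?thesis
    using tangent_line_scaled_iff[OF pos xy] uminus_image_tangent_line_scaled_iff[OF pos uv]
    by blast
qed

text \<open>Used in both directions: sides of members give points of the circle, and points of the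
  circle give chords that are sides of members.\<close>

lemma confocal_chord_iff_norm:
  assumes pos: "a > 0" "b > 0" and g: "g > 0" and el: "p \<in> ellipse a b" "q \<in> ellipse a b"
    and C: "cross p q \<noteq> 0"
    and z: "z \<in> tangent_line a b p" "z \<in> uminus ` tangent_line a b q"
  shows "confocal_chord a b ((a * b * g)\<^sup>2) p q \<longleftrightarrow> norm z = 1 / g"
proof -
  obtain x y where p: "p = (a * x, b * y)" and xy: "x\<^sup>2 + y\<^sup>2 = 1"
    using ellipse_scaledE[OF pos el(1)] .
  obtain u v where q: "q = (a * u, b * v)" and uv: "u\<^sup>2 + v\<^sup>2 = 1"
    using ellipse_scaledE[OF pos el(2)] .
  define K D where "K = x * v - y * u" and "D = x * u + y * v"
  have K: "K \<noteq> 0" using C by (auto simp: p q cross_scaled K_def)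
  have KD: "K\<^sup>2 = (1 - D) * (1 + D)" using xy uv unfolding K_def D_def by algebra
  then have D: "1 - D \<noteq> 0" "1 + D \<noteq> 0" using K by auto
  \<comment> \<open>The sum and difference of two unit vectors are perpendicular, with squared
    lengths \<open>2 * (1 + D)\<close> and \<open>2 * (1 - D)\<close>.\<close>
  have "(y + v)\<^sup>2 * (1 - D) = (x - u)\<^sup>2 * (1 + D)" "(x + u)\<^sup>2 * (1 - D) = (y - v)\<^sup>2 * (1 + D)"
    using xy uv unfolding D_def by algebra+
  then have W: "(a\<^sup>2 * (y + v)\<^sup>2 + b\<^sup>2 * (x + u)\<^sup>2) * (1 - D) =
      (a\<^sup>2 * (x - u)\<^sup>2 + b\<^sup>2 * (y - v)\<^sup>2) * (1 + D)"
    (is "(_ * ?Y + _ * ?X) * _ = _")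
  proof -
    assume e: "?Y * (1 - D) = (x - u)\<^sup>2 * (1 + D)" "?X * (1 - D) = (y - v)\<^sup>2 * (1 + D)"
    have "(a\<^sup>2 * ?Y + b\<^sup>2 * ?X) * (1 - D) = a\<^sup>2 * (?Y * (1 - D)) + b\<^sup>2 * (?X * (1 - D))"
      by (simp add: distrib_right)
    then show ?thesis unfolding e by (simp add: distrib_right)
  qed
  define L where "L = a\<^sup>2 * (x - u)\<^sup>2 + b\<^sup>2 * (y - v)\<^sup>2"
  have "z = (a * ((y + v) / K), - b * ((x + u) / K))"
    using tangent_inter_reflected_tangent[OF pos xy uv] K z unfolding p q K_def by blast
  then have "(norm z)\<^sup>2 = (a\<^sup>2 * (y + v)\<^sup>2 + b\<^sup>2 * (x + u)\<^sup>2) / K\<^sup>2"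
    by (simp add: norm_sq_pair power_mult_distrib power_divide add_divide_distrib[of "_ * _"])
  also have "\<dots> = L / (1 - D)\<^sup>2"
    using W D unfolding KD L_def by (simp add: divide_simps power2_eq_square mult_ac)
  finally have nz: "(norm z)\<^sup>2 = L / (1 - D)\<^sup>2" .
  have "confocal_chord a b ((a * b * g)\<^sup>2) p q \<longleftrightarrow> (a * b)\<^sup>2 * (g\<^sup>2 * L) = (a * b)\<^sup>2 * (1 - D)\<^sup>2"
    unfolding p q confocal_chord_scaled[OF pos] L_def D_def
    by (simp add: power_mult_distrib diff_diff_eq mult.assoc)
  also have "\<dots> \<longleftrightarrow> g\<^sup>2 * L = (1 - D)\<^sup>2" using pos by simp
  also have "\<dots> \<longleftrightarrow> (norm z)\<^sup>2 = (1 / g)\<^sup>2"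
    using g D unfolding nz by (auto simp: field_simps)
  also have "\<dots> \<longleftrightarrow> norm z = 1 / g" using g by (simp add: power2_eq_iff_nonneg)
  finally show ?thesis .
qed

text \<open>After scaling \<open>E\<close> to the unit circle, two tangents pass through an exterior
  point. Exchanging their roles reverses the sense of rotation, so \<open>\<sigma>\<close>, which is
  1 or -1, can prescribe it.\<close>

lemma exterior_point_tangents:
  assumes pos: "a > 0" "b > 0" and z: "ellipse_form a b z > 1" and sg: "\<sigma>\<^sup>2 = (1::real)"
  obtains p q where "p \<in> ellipse a b" "q \<in> ellipse a b" "\<sigma> * cross p q > 0"
    "z \<in> tangent_line a b p" "z \<in> uminus ` tangent_line a b q"
proof -
  define f g where "f = fst z / a" and "g = snd z / b"
  define R k where "R = f\<^sup>2 + g\<^sup>2" and "k = \<sigma> * sqrt (R - 1)"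
  have R: "R > 1" using z by (simp add: R_def f_def g_def ellipse_form_def)
  have k: "k\<^sup>2 = R - 1" using R sg by (simp add: k_def power_mult_distrib)
  have fg: "f\<^sup>2 + g\<^sup>2 = R" by (simp add: R_def)
  \<comment> \<open>\<open>(f, g) / R\<close> is the foot of the origin on the chord of contact;
    moving by \<open>k / R\<close> times the perpendicular \<open>(- g, f)\<close> gives one contact
    point. The other is \<open>(f + k * g, g - k * f) / R\<close>, and \<open>(u, v)\<close> is its
    antipode.\<close>
  define x y u v where "x = (f - k * g) / R" and "y = (g + k * f) / R"
    and "u = (- f - k * g) / R" and "v = (- g + k * f) / R"
  have "(f - k * g)\<^sup>2 + (g + k * f)\<^sup>2 = (f\<^sup>2 + g\<^sup>2) * (1 + k\<^sup>2)"
    "(- f - k * g)\<^sup>2 + (- g + k * f)\<^sup>2 = (f\<^sup>2 + g\<^sup>2) * (1 + k\<^sup>2)"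
    by (simp_all add: power2_eq_square algebra_simps)
  then have "(f - k * g)\<^sup>2 + (g + k * f)\<^sup>2 = R\<^sup>2" "(- f - k * g)\<^sup>2 + (- g + k * f)\<^sup>2 = R\<^sup>2"
    unfolding fg k by (simp_all add: power2_eq_square)
  then have xy: "x\<^sup>2 + y\<^sup>2 = 1" and uv: "u\<^sup>2 + v\<^sup>2 = 1"
    using R by (simp_all add: x_def y_def u_def v_def power_divide add_divide_distrib[symmetric])
  have "x * v - y * u = ((f - k * g) * (- g + k * f) - (g + k * f) * (- f - k * g)) / R\<^sup>2"
    by (simp only: x_def y_def u_def v_def power2_eq_square diff_divide_distrib[of "_ * _"] times_divide_times_eq)
  also have "(f - k * g) * (- g + k * f) - (g + k * f) * (- f - k * g) = 2 * k * R"
    unfolding fg[symmetric] by (simp add: power2_eq_square algebra_simps)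
  finally have "\<sigma> * (x * v - y * u) = 2 * \<sigma>\<^sup>2 * sqrt (R - 1) / R"
    using R by (simp add: k_def power2_eq_square)
  then have "\<sigma> * (x * v - y * u) > 0" using R sg by simp
  then have "(a * b) * (\<sigma> * (x * v - y * u)) > 0" using pos by simp
  then have cr: "\<sigma> * cross (a * x, b * y) (a * u, b * v) > 0"
    by (simp add: cross_scaled mult_ac)
  have "f * (f - k * g) + g * (g + k * f) = R" "f * (- f - k * g) + g * (- g + k * f) = - R"
    unfolding fg[symmetric] by (simp_all add: power2_eq_square algebra_simps)
  then have "f * x + g * y = 1" "f * u + g * v = - 1"
    using R by (simp_all add: x_def y_def u_def v_def add_divide_distrib[symmetric])
  then show thesis
    using that[of "(a * x, b * y)" "(a * u, b * v)"] cr xy uv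
    by (simp add: ellipse_scaled_iff[OF pos] tangent_line_scaled_iff[OF pos]
        uminus_image_tangent_line_scaled_iff[OF pos] f_def g_def)
qed

section \<open>The locus for the whole family\<close>

theorem theorem14:
  fixes a b \<gamma> :: real and N :: nat and F :: "(int \<Rightarrow> real \<times> real) set"
    and Q :: "int \<Rightarrow> real \<times> real" and i k :: int
  assumes "N \<ge> 3" and "a > 0" and "b > 0"
    and "periodic_family a b N F"
    and "Q \<in> F" and "\<gamma> = joachimsthal a b Q k"
  shows "\<gamma> > 0 \<and>
    (\<forall>P\<in>F. \<exists>z. tangent_line a b (P i) \<inter> uminus ` tangent_line a b (P (i + 1)) = {z}) \<and>
    {z. \<exists>P\<in>F. tangent_line a b (P i) \<inter> uminus ` tangent_line a b (P (i + 1)) = {z}}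
      = sphere 0 (1 / \<gamma>)"
proof -
  note pos = assms(2,3)
  note fam = assms(4)[unfolded periodic_family_def]
  have el: "P j \<in> ellipse a b" and ne: "P (j + 1) \<noteq> P j" if "P \<in> F" for P j
    using fam that by (auto simp: periodic_trajectory_def)
  obtain a' b' where c: "caustic_of a b a' b'"
    and t: "\<And>P j. P \<in> F \<Longrightarrow> \<exists>q\<in>ellipse a' b'. affine hull {P j, P (j + 1)} = tangent_line a' b' q"
    using fam by blast
  define l where "l = a\<^sup>2 - a'\<^sup>2"
  have ch: "confocal_chord a b l (P j) (P (j + 1))" if PF: "P \<in> F" for P j
  proof -
    obtain q where "q \<in> ellipse a' b'" "affine hull {P j, P (j + 1)} = tangent_line a' b' q"
      using t[OF PF] by blast
    moreover have "P j \<in> affine hull {P j, P (j + 1)}" "P (j + 1) \<in> affine hull {P j, P (j + 1)}"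
      by (simp_all add: hull_inc)
    ultimately show ?thesis
      unfolding l_def using confocal_chord_if_tangent[OF pos c el[OF PF] el[OF PF]] by blast
  qed
  \<comment> \<open>A sign encodes the common sense of rotation, so both senses are treated at
    once.\<close>
  obtain \<sigma> :: real where sg: "\<sigma>\<^sup>2 = 1" and cr: "\<And>P j. P \<in> F \<Longrightarrow> \<sigma> * cross (P j) (P (j + 1)) > 0"
  proof -
    consider "\<And>P j. P \<in> F \<Longrightarrow> cross (P j) (P (j + 1)) > 0"
      | "\<And>P j. P \<in> F \<Longrightarrow> cross (P j) (P (j + 1)) < 0"
      using fam by blast
    then show thesis
    proof cases
      case 1 then show thesis using that[of 1] by simp
    next
      case 2 then show thesis using that[of "-1"] by simp
    qed
  qed
  have cr': "cross (P j) (P (j + 1)) * cross (R j') (R (j' + 1)) > 0" if "P \<in> F" "R \<in> F" for P R j j'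
  proof -
    have "\<sigma>\<^sup>2 * (cross (P j) (P (j + 1)) * cross (R j') (R (j' + 1))) > 0"
      using mult_pos_pos[OF cr[OF that(1), of j] cr[OF that(2), of j']]
      by (simp add: power2_eq_square mult_ac)
    then show ?thesis by (simp add: sg)
  qed
  have \<gamma>: "\<gamma> > 0" "l = (a * b * \<gamma>)\<^sup>2"
    using joachimsthal_confocal_chord[OF pos, of Q k l] el[OF assms(5)]
      ne[OF assms(5), of "k - 1"] ch[OF assms(5), of "k - 1"] assms(6) by simp_all
  have pos': "a' > 0" "b' > 0" using c by (auto simp: caustic_of_def)
  have l': "l = b\<^sup>2 - b'\<^sup>2" using caustic_of_confocal[OF pos c] by (simp add: l_def)
  have l: "0 < l" "l < a\<^sup>2" "l < b\<^sup>2"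
  proof -
    show "0 < l" using \<gamma> pos by simp
    show "l < a\<^sup>2" using pos' by (simp add: l_def)
    show "l < b\<^sup>2" using pos' by (simp add: l')
  qed
  note unique = confocal_chord_unique[OF pos l]
  \<comment> \<open>Members sharing a vertex, possibly at different indices, agree up to a shift.
    Uniqueness fixes the next vertex and, for the reversed chord, the previous one.\<close>
  have coincide: "P (1 + j) = R (m + j)" if PR: "P \<in> F" "R \<in> F" and P1: "P 1 = R m" for P R m j
  proof (induction j rule: int_induct[of _ 0])
    case base
    then show ?case using P1 by simp
  next
    case (step1 j)
    have "P (1 + j + 1) = R (m + j + 1)"
      using unique[OF el[OF PR(1), of "1 + j"] el[OF PR(1), of "1 + j + 1"] el[OF PR(2), of "m + j + 1"]]
        ch[OF PR(1), of "1 + j"] ch[OF PR(2), of "m + j"]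
        cr'[OF PR, of "1 + j" "m + j"] step1(2) by simp
    then show ?case by (simp add: add_ac)
  next
    case (step2 j)
    have "cross (P j) (P (1 + j)) * cross (R (m + j - 1)) (P (1 + j)) > 0"
      using cr'[OF PR, of j "m + j - 1"] step2(2) by (simp add: add_ac)
    then have "cross (P (1 + j)) (P j) * cross (P (1 + j)) (R (m + j - 1)) > 0"
      by (simp add: cross_commute[of _ "P (1 + j)"])
    moreover have "confocal_chord a b l (P (1 + j)) (P j)"
      using ch[OF PR(1), of j] confocal_chord_commute by (simp add: add_ac)
    moreover have "confocal_chord a b l (P (1 + j)) (R (m + j - 1))"
      using ch[OF PR(2), of "m + j - 1"] step2(2) confocal_chord_commute by simp
    ultimately have "P j = R (m + j - 1)"
      using unique el PR by blast
    then show ?case by (simp add: add_diff_eq)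
  qed
  \<comment> \<open>The family provides members with prescribed \<open>P 1\<close> only; shifting
    the index extends this to \<open>P i\<close>.\<close>
  have start: "\<exists>P\<in>F. P i = p" if p: "p \<in> ellipse a b" for p
  proof -
    obtain R where R: "R \<in> F" "R 1 = p" using fam p by blast
    \<comment> \<open>The index is \<open>2 - i\<close> because moving on by \<open>i - 1\<close>
      takes \<open>P 1\<close> to \<open>P i\<close> and \<open>R (2 - i)\<close> to
      \<open>R 1\<close>.\<close>
    obtain P where P: "P \<in> F" "P 1 = R (2 - i)" using fam el[OF R(1)] by blast
    have "P i = p" using coincide[OF P(1) R(1) P(2), of "i - 1"] R(2) by simp
    then show ?thesis using P(1) by blast
  qed
  have cr0: "cross (P i) (P (i + 1)) \<noteq> 0" if "P \<in> F" for P
    using cr[OF that, of i] by auto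
  have inter: "\<exists>z. tangent_line a b p \<inter> uminus ` tangent_line a b q = {z}"
    if pq: "p \<in> ellipse a b" "q \<in> ellipse a b" "cross p q \<noteq> 0" for p q
  proof -
    obtain x y where p: "p = (a * x, b * y)" "x\<^sup>2 + y\<^sup>2 = 1"
      using ellipse_scaledE[OF pos pq(1)] .
    obtain u v where q: "q = (a * u, b * v)" "u\<^sup>2 + v\<^sup>2 = 1"
      using ellipse_scaledE[OF pos pq(2)] .
    have "x * v - y * u \<noteq> 0" using pq(3) by (auto simp: p q cross_scaled)
    from tangent_inter_reflected_tangent[OF pos p(2) q(2) this] show ?thesis
      unfolding p q by blast
  qed
  have "norm z = 1 / \<gamma>"
    if "P \<in> F" "tangent_line a b (P i) \<inter> uminus ` tangent_line a b (P (i + 1)) = {z}" for P z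
    using confocal_chord_iff_norm[OF pos \<gamma>(1) el[OF that(1)] el[OF that(1)] cr0[OF that(1)]]
      ch[OF that(1), of i] that(2) unfolding \<gamma>(2) by blast
  moreover have "\<exists>P\<in>F. tangent_line a b (P i) \<inter> uminus ` tangent_line a b (P (i + 1)) = {z}"
    if z: "norm z = 1 / \<gamma>" for z
  proof -
    define f g where "f = fst z / a" and "g = snd z / b"
    have "a\<^sup>2 * f\<^sup>2 + b\<^sup>2 * g\<^sup>2 = (norm z)\<^sup>2"
      using norm_sq_pair[of "fst z" "snd z"] pos by (simp add: f_def g_def power_divide)
    also have "\<dots> = a\<^sup>2 * b\<^sup>2 / l"
      using \<gamma> pos by (simp add: z power_divide power_mult_distrib)
    finally have R: "l * (a\<^sup>2 * f\<^sup>2 + b\<^sup>2 * g\<^sup>2) = a\<^sup>2 * b\<^sup>2" using l by simp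
    \<comment> \<open>The circle encloses \<open>E\<close>: by \<open>R\<close>,
      \<open>a^2 b^2 (f^2 + g^2 - 1)\<close> equals
      \<open>(b^2 - l) a^2 f^2 + (a^2 - l) b^2 g^2\<close>.\<close>
    have "f\<^sup>2 + g\<^sup>2 > 1"
    proof -
      have nz: "f \<noteq> 0 \<or> g \<noteq> 0" using R pos by auto
      have "(b\<^sup>2 - l) * a\<^sup>2 * f\<^sup>2 + (a\<^sup>2 - l) * b\<^sup>2 * g\<^sup>2 > 0"
        using nz l pos by (auto intro: add_pos_nonneg add_nonneg_pos)
      then have "a\<^sup>2 * b\<^sup>2 * 1 < a\<^sup>2 * b\<^sup>2 * (f\<^sup>2 + g\<^sup>2)"
        using R by (simp add: algebra_simps)
      moreover have "a\<^sup>2 * b\<^sup>2 > 0" using pos by simp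
      ultimately show ?thesis using mult_less_cancel_left_pos by blast
    qed
    then have "ellipse_form a b z > 1" by (simp add: ellipse_form_def f_def g_def)
    then obtain p q where pq: "p \<in> ellipse a b" "q \<in> ellipse a b" "\<sigma> * cross p q > 0"
      "z \<in> tangent_line a b p" "z \<in> uminus ` tangent_line a b q"
      using exterior_point_tangents[OF pos _ sg] by metis
    then have cpq: "cross p q \<noteq> 0" by auto
    have chpq: "confocal_chord a b l p q"
      using confocal_chord_iff_norm[OF pos \<gamma>(1) pq(1,2) cpq pq(4,5)] z \<gamma>(2) by simp
    obtain P where P: "P \<in> F" "P i = p" using start pq(1) by blast
    \<comment> \<open>The side of \<open>P\<close> from \<open>p\<close> and the chord from
      \<open>p\<close> to \<open>q\<close> turn in the same sense, as uniqueness requires.\<close>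
    have "\<sigma>\<^sup>2 * (cross p (P (i + 1)) * cross p q) > 0"
      using mult_pos_pos[OF cr[OF P(1), of i] pq(3)] P(2) by (simp add: power2_eq_square mult_ac)
    then have "P (i + 1) = q"
      using unique[OF pq(1) el[OF P(1)] pq(2) _ chpq] ch[OF P(1), of i] P(2) sg by simp
    moreover have "tangent_line a b p \<inter> uminus ` tangent_line a b q = {z}"
      using inter[OF pq(1,2) cpq] pq(4,5) by (metis IntI singletonD)
    ultimately show ?thesis using P by blast
  qed
  ultimately have "{z. \<exists>P\<in>F. tangent_line a b (P i) \<inter> uminus ` tangent_line a b (P (i + 1)) = {z}}
      = sphere 0 (1 / \<gamma>)"
    by auto
  moreover have "\<forall>P\<in>F. \<exists>z. tangent_line a b (P i) \<inter> uminus ` tangent_line a b (P (i + 1)) = {z}"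
    by (intro ballI inter el cr0)
  ultimately show ?thesis using \<gamma>(1) by (intro conjI)
qed

end
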